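(* Let $V$ be a grading-restricted vertex algebra, and let $I\subseteq U^\infty(V)$ be the two-sided ideal of the (nonassociative) algebra $(U^\infty(V),\diamond)$ generated by $O^\infty(V)$ and $J^\infty(V)$. Then elements of $I$ satisfy the diagonal shift property: for all $v\in V$ and $k,l\in\mathbb{Z}_+$ with $[v]_{kl}\in I$, one has $[v]_{kl}\in Q^\infty(V)$ and $[v]_{k-1,l-1}\in Q^\infty(V)$.
   Context: All vector spaces are over $\mathbb{C}$; $\mathbb{N}=\{0,1,2,\dots\}$, $\mathbb{Z}_+=\{1,2,\dots\}$; $\binom{a}{m}=a(a-1)\cdots(a-m+1)/m!$ for $a\in\mathbb{Z}$, $m\in\mathbb{N}$. $\mathrm{Res}_x$ denotes the coefficient of $x^{-1}$, and powers of $(1+x)$ are expanded in nonnegative powers of $x$. **Grading-restricted vertex algebra.** A $\mathbb{Z}$-graded vector space $V=\coprod_{n\in\mathbb{Z}}V_{(n)}$ with a linear map $V\to(\mathrm{End}\,V)[[x,x^{-1}]]$, $v\mapsto Y(v,x)=\sum_{n\in\mathbb{Z}}v_nx^{-n-1}$, and a vector $\mathbf{1}\in V_{(0)}$ such that for all $a,b\in V$: (I) $\dim V_{(n)}<\infty$ for all $n$ and $V_{(n)}=0$ for $n$ sufficiently negative; (II) $a_nb=0$ for $n$ sufficiently large; (III) $Y(\mathbf{1},x)=1$; (IV) $Y(a,x)\mathbf{1}\in V[[x]]$ and $\lim_{x\to0}Y(a,x)\mathbf{1}=a$; (V) Jacobi identity: for all $l,m,n\in\mathbb{Z}$, $$\sum_{i\ge0}\binom{m}{i}(a_{l+i}b)_{m+n-i}=\sum_{i\ge0}(-1)^i\binom{l}{i}a_{m+l-i}b_{n+i}-\sum_{i\ge0}(-1)^{l+i}\binom{l}{i}b_{n+l-i}a_{m+i};$$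 (VI) with $L(0)v=nv$ for $v\in V_{(n)}$, $[L(0),Y(a,x)]=Y(L(0)a,x)+x\frac{d}{dx}Y(a,x)$; (VII) with $L(-1)v=\mathrm{Res}_xx^{-2}Y(v,x)\mathbf{1}$, $\frac{d}{dx}Y(a,x)=Y(L(-1)a,x)=[L(-1),Y(a,x)]$. If $v\in V_{(n)}$, $v$ is homogeneous with $\mathrm{wt}\,v=n$; then $x^{L(0)}v=x^{\mathrm{wt}\,v}v$ and $(1+x)^{L(0)}v=(1+x)^{\mathrm{wt}\,v}v$, extended linearly. **Lower-bounded generalized $V$-module.** A $\mathbb{C}$-graded vector space $W=\coprod_{n\in\mathbb{C}}W_{(n)}$ with a linear map $V\to(\mathrm{End}\,W)[[x,x^{-1}]]$, $v\mapsto Y_W(v,x)=\sum_{n\in\mathbb{Z}}v_nx^{-n-1}$, such that: $W_{(n)}=0$ when $\mathrm{Re}\,n$ is sufficiently negative; for $a\in V,b\in W$, $a_nb=0$ for $n$ sufficiently large; $Y_W(\mathbf{1},x)=1$; the Jacobi identity (V) holds as an identity of operators on $W$ for $a,b\in V$; there is an operator $L_W(0)$ on $W$ with $[L_W(0),Y_W(a,x)]=Y_W(L(0)a,x)+x\frac{d}{dx}Y_W(a,x)$ and $W_{(n)}=\{w\in W\mid (L_W(0)-n)^kw=0\text{ for some }k\in\mathbb{Z}_+\}$; there is an operator $L_W(-1)$ on $W$ with $\frac{d}{dx}Y_W(u,x)=Y_W(L(-1)u,x)=[L_W(-1),Y_W(u,x)]$ for $u\in V$. **$U^\infty(V)$ and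 $\diamond$.** $U^\infty(V)$ is the space of column-finite infinite matrices with entries in $V$, with rows and columns indexed by $\mathbb{N}$ (each column has only finitely many nonzero entries). For $v\in V$, $[v]_{kl}$ is the matrix with entry $v$ in position $(k,l)$ and $0$ elsewhere. The product $\diamond$ is given by $[u]_{km}\diamond[v]_{nl}=0$ if $m\neq n$ and $$[u]_{kn}\diamond[v]_{nl}=\sum_{m=0}^n\binom{-k+n-l-1}{m}\mathrm{Res}_x\,x^{-k+n-l-m-1}(1+x)^l\,[Y((1+x)^{L(0)}u,x)v]_{kl},$$ extended linearly: the $(k,l)$ component of $A\diamond B$ is $\sum_n[a_{kn}]_{kn}\diamond[b_{nl}]_{nl}$, a finite sum. A two-sided ideal is a subspace closed under left and right $\diamond$-multiplication by all of $U^\infty(V)$; the ideal generated by a set is the smallest one containing it. **$Q^\infty(V)$.** For a lower-bounded generalized $V$-module $W$ and $n\in\mathbb{N}$ let $\Omega_n(W)=\{w\in W\mid v_kw=0\text{ for all homogeneous }v\in V\text{ and }k\in\mathbb{Z}\text{ with }\mathrm{wt}\,v-k-1<-n\}$, $\Omega_{-1}(W)=0$, $\mathrm{Gr}_n(W)=\Omega_n(W)/\Omega_{n-1}(W)$, $\mathrm{Gr}(W)=\bigoplus_{n\in\mathbb{N}}\mathrm{Gr}_n(W)$, and for $w\in\Omega_n(W)$ let $[w]_n=w+\Omega_{n-1}(W)$. Define $\vartheta_{\mathrm{Gr}(W)}:U^\infty(V)\to\mathrm{End}\,\mathrm{Gr}(W)$ linearly by $\vartheta_{\mathrm{Gr}(W)}([v]_{kl})[w]_n=\delta_{ln}[\mathrm{Res}_x\,x^{l-k-1}Y_W(x^{L(0)}v,x)w]_k$.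 Then $Q^\infty(V)=\bigcap_W\ker\vartheta_{\mathrm{Gr}(W)}$ over all lower-bounded generalized $V$-modules $W$. **$O^\infty(V)$.** The subspace of $U^\infty(V)$ spanned by infinite linear combinations of elements $\mathrm{Res}_x\,x^{-k-l-p-2}(1+x)^l[Y((1+x)^{L(0)}u,x)v]_{kl}$ ($u,v\in V$, $k,l,p\in\mathbb{N}$) and $[(L(-1)+L(0)+l-k)v]_{kl}$ ($v\in V$, $k,l\in\mathbb{N}$), with each pair $(k,l)$ appearing only finitely many times. **$J^\infty(V)$.** The subspace of $U^\infty(V)$ spanned by the elements $$\sum_{\substack{j\in\mathbb{N}\\ n+p-j\ge0}}(-1)^j\binom{p}{j}[v]_{k,n+p-j}\diamond[u]_{n+p-j,l+p}-\sum_{\substack{j\in\mathbb{N}\\ l-n+k+p-j\ge0}}(-1)^{p-j}\binom{p}{j}[u]_{k,l-n+k+p-j}\diamond[v]_{l-n+k+p-j,l+p}-\sum_{j\in\mathbb{N}}\binom{\mathrm{wt}\,v+n-k-1}{j}[v_{p+j}u]_{k,l+p}$$ for $k\in\mathbb{N}$, $l,p,n\in\mathbb{Z}$ with $l+p\in\mathbb{N}$, and $u,v\in V$ with $v$ homogeneous. **Diagonal shift property.** For $v\in V$, $k,l\in\mathbb{Z}_+$ with $[v]_{kl}\in Q^\infty(V)$, the element $[v]_{kl}$ satisfies the diagonal shift property if $[v]_{k-1,l-1}\in Q^\infty(V)$. *)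

theory Defs
  imports
    Complex_Main
    "HOL-Library.Function_Algebras"
    "HOL-Library.Groups_Big_Fun"
begin

text \<open>
  All series over \<open>\<nat>\<close> below have only finitely many nonzero terms, by the truncation axioms,
  and are written with \<^const>\<open>Sum_any\<close>, the sum of a finitely supported function.
\<close>

definition decomposes :: "('i \<Rightarrow> 'a::ab_group_add set) \<Rightarrow> 'a \<Rightarrow> ('i \<Rightarrow> 'a) \<Rightarrow> bool" where
  "decomposes S v f \<longleftrightarrow>
     (\<forall>i. f i \<in> S i) \<and> finite {i. f i \<noteq> 0} \<and> v = (\<Sum>i | f i \<noteq> 0. f i)"

definition internal_direct_sum ::
    "(complex \<Rightarrow> 'a::ab_group_add \<Rightarrow> 'a) \<Rightarrow> ('i \<Rightarrow> 'a set) \<Rightarrow> bool" where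
  "internal_direct_sum scale S \<longleftrightarrow>
     (\<forall>i. module.subspace scale (S i)) \<and> (\<forall>v. \<exists>!f. decomposes S v f)"

definition component :: "('i \<Rightarrow> 'a::ab_group_add set) \<Rightarrow> 'i \<Rightarrow> 'a \<Rightarrow> 'a" where
  "component S i v = (THE f. decomposes S v f) i"

text \<open>
  The underlying space is the whole type \<open>'v\<close>. \<open>mode V v n\<close> is the operator \<open>v\<^sub>n\<close>, the coefficient of
  \<open>x\<close> to the power \<open>-n-1\<close> in \<open>Y(v,x)\<close>; identities of formal series are stated coefficientwise,
  comparing the coefficients of that power.
\<close>

record 'v vertex_data =
  vscale :: "complex \<Rightarrow> 'v \<Rightarrow> 'v"
  vgrade :: "int \<Rightarrow> 'v set"
  mode :: "'v \<Rightarrow> int \<Rightarrow> 'v \<Rightarrow> 'v"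
  vacuum :: 'v

definition L0 :: "'v::ab_group_add vertex_data \<Rightarrow> 'v \<Rightarrow> 'v" where
  "L0 V v = Sum_any (\<lambda>n. vscale V (of_int n) (component (vgrade V) n v))"

definition Lm1 :: "'v::ab_group_add vertex_data \<Rightarrow> 'v \<Rightarrow> 'v" where
  "Lm1 V v = mode V v (- 2) (vacuum V)"

locale grading_restricted_vertex_algebra =
  fixes V :: "'v::ab_group_add vertex_data"
  assumes carrier_vector_space: "vector_space (vscale V)"
    and grading: "internal_direct_sum (vscale V) (vgrade V)"
    and mode_linear_left:
      "Vector_Spaces.linear (vscale V) (vscale V) (\<lambda>v. mode V v n w)"
    and mode_linear_right:
      "Vector_Spaces.linear (vscale V) (vscale V) (mode V v n)"
    and vacuum_weight: "vacuum V \<in> vgrade V 0"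
    and grade_finite_dim:
      "\<exists>B. finite B \<and> vgrade V n = module.span (vscale V) B"
    and grade_lower_bounded: "\<exists>N. \<forall>n<N. vgrade V n = {0}"
    and truncation: "\<exists>N. \<forall>n\<ge>N. mode V a n b = 0"
    and vacuum_left: "mode V (vacuum V) n b = (if n = - 1 then b else 0)"
    and vacuum_right: "n \<ge> 0 \<Longrightarrow> mode V a n (vacuum V) = 0"
    and creation: "mode V a (- 1) (vacuum V) = a"
    and jacobi:
      "Sum_any (\<lambda>i::nat. vscale V (of_int m gchoose i)
           (mode V (mode V a (l + int i) b) (m + n - int i) c))
       = Sum_any (\<lambda>i::nat. vscale V ((- 1) ^ i * (of_int l gchoose i))
           (mode V a (m + l - int i) (mode V b (n + int i) c)))
       - Sum_any (\<lambda>i::nat. vscale V ((- 1) powi (l + int i) * (of_int l gchoose i))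
           (mode V b (n + l - int i) (mode V a (m + int i) c)))"
    and L0_bracket:
      "L0 V (mode V a n b) - mode V a n (L0 V b)
       = mode V (L0 V a) n b + vscale V (of_int (- n - 1)) (mode V a n b)"
    and Lm1_derivative:
      "mode V (Lm1 V a) n b = vscale V (of_int (- n)) (mode V a (n - 1) b)"
    and Lm1_bracket:
      "Lm1 V (mode V a n b) - mode V a n (Lm1 V b) = mode V (Lm1 V a) n b"

record ('v, 'w) module_data =
  wscale :: "complex \<Rightarrow> 'w \<Rightarrow> 'w"
  wgrade :: "complex \<Rightarrow> 'w set"
  wmode :: "'v \<Rightarrow> int \<Rightarrow> 'w \<Rightarrow> 'w"

locale lower_bounded_generalized_module =
  grading_restricted_vertex_algebra V
  for V :: "'v::ab_group_add vertex_data" +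
  fixes W :: "('v, 'w::ab_group_add) module_data"
  assumes module_vector_space: "vector_space (wscale W)"
    and module_grading: "internal_direct_sum (wscale W) (wgrade W)"
    and wmode_linear_left:
      "Vector_Spaces.linear (vscale V) (wscale W) (\<lambda>v. wmode W v n w)"
    and wmode_linear_right:
      "Vector_Spaces.linear (wscale W) (wscale W) (wmode W v n)"
    and module_lower_bounded: "\<exists>N::real. \<forall>n. Re n < N \<longrightarrow> wgrade W n = {0}"
    and module_truncation: "\<exists>N. \<forall>n\<ge>N. wmode W a n w = 0"
    and module_vacuum: "wmode W (vacuum V) n w = (if n = - 1 then w else 0)"
    and module_jacobi:
      "Sum_any (\<lambda>i::nat. wscale W (of_int m gchoose i)
           (wmode W (mode V a (l + int i) b) (m + n - int i) w))
       = Sum_any (\<lambda>i::nat. wscale W ((- 1) ^ i * (of_int l gchoose i))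
           (wmode W a (m + l - int i) (wmode W b (n + int i) w)))
       - Sum_any (\<lambda>i::nat. wscale W ((- 1) powi (l + int i) * (of_int l gchoose i))
           (wmode W b (n + l - int i) (wmode W a (m + int i) w)))"
    and module_L0:
      "\<exists>LW0. Vector_Spaces.linear (wscale W) (wscale W) LW0 \<and>
         (\<forall>a n w. LW0 (wmode W a n w) - wmode W a n (LW0 w)
            = wmode W (L0 V a) n w + wscale W (of_int (- n - 1)) (wmode W a n w)) \<and>
         (\<forall>n. wgrade W n = {w. \<exists>k\<ge>1. ((\<lambda>y. LW0 y - wscale W n y) ^^ k) w = 0})"
    and module_Lm1:
      "\<exists>LWm1. Vector_Spaces.linear (wscale W) (wscale W) LWm1 \<and>
         (\<forall>u n w. wmode W (Lm1 V u) n w = wscale W (of_int (- n)) (wmode W u (n - 1) w) \<and>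
            LWm1 (wmode W u n w) - wmode W u n (LWm1 w) = wmode W (Lm1 V u) n w)"

definition U_infty :: "(nat \<Rightarrow> nat \<Rightarrow> 'v::ab_group_add) set" where
  "U_infty = {A. \<forall>l. finite {k. A k l \<noteq> 0}}"

definition mscale ::
    "'v vertex_data \<Rightarrow> complex \<Rightarrow> (nat \<Rightarrow> nat \<Rightarrow> 'v) \<Rightarrow> nat \<Rightarrow> nat \<Rightarrow> 'v" where
  "mscale V c A = (\<lambda>k l. vscale V c (A k l))"

definition matrix_unit :: "'v::ab_group_add \<Rightarrow> nat \<Rightarrow> nat \<Rightarrow> nat \<Rightarrow> nat \<Rightarrow> 'v" where
  "matrix_unit v k l = (\<lambda>i j. if i = k \<and> j = l then v else 0)"

text \<open>
  \<open>res_Y V s l u v\<close> is the coefficient of \<open>x\<close> to the power \<open>-1\<close> in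
  \<open>x\<^sup>s (1+x)\<^sup>l Y((1+x)\<^bsup>L(0)\<^esup> u, x) v\<close>: on the weight \<open>h\<close> component of \<open>u\<close>, the powers of \<open>1+x\<close>
  combine to exponent \<open>l + h\<close>, and the term \<open>x\<close> to the power \<open>s + i\<close> picks out the mode \<open>s + i\<close>.
\<close>

definition res_Y :: "'v::ab_group_add vertex_data \<Rightarrow> int \<Rightarrow> int \<Rightarrow> 'v \<Rightarrow> 'v \<Rightarrow> 'v" where
  "res_Y V s l u v =
     Sum_any (\<lambda>h. Sum_any (\<lambda>i::nat.
       vscale V (of_int (l + h) gchoose i) (mode V (component (vgrade V) h u) (s + int i) v)))"

definition diamond_entry ::
    "'v::ab_group_add vertex_data \<Rightarrow> nat \<Rightarrow> nat \<Rightarrow> nat \<Rightarrow> 'v \<Rightarrow> 'v \<Rightarrow> 'v" where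
  "diamond_entry V k n l u v =
     (\<Sum>m = 0..n. vscale V (of_int (- int k + int n - int l - 1) gchoose m)
        (res_Y V (- int k + int n - int l - int m - 1) (int l) u v))"

definition diamond ::
    "'v::ab_group_add vertex_data \<Rightarrow> (nat \<Rightarrow> nat \<Rightarrow> 'v) \<Rightarrow> (nat \<Rightarrow> nat \<Rightarrow> 'v) \<Rightarrow> nat \<Rightarrow> nat \<Rightarrow> 'v" where
  "diamond V A B = (\<lambda>k l. \<Sum>n | B n l \<noteq> 0. diamond_entry V k n l (A k n) (B n l))"

definition two_sided_ideal ::
    "'v::ab_group_add vertex_data \<Rightarrow> (nat \<Rightarrow> nat \<Rightarrow> 'v) set \<Rightarrow> bool" where
  "two_sided_ideal V S \<longleftrightarrow>
     S \<subseteq> U_infty \<and> module.subspace (mscale V) S \<and>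
     (\<forall>A\<in>U_infty. \<forall>B\<in>S. diamond V A B \<in> S \<and> diamond V B A \<in> S)"

definition ideal_generated ::
    "'v::ab_group_add vertex_data \<Rightarrow> (nat \<Rightarrow> nat \<Rightarrow> 'v) set \<Rightarrow> (nat \<Rightarrow> nat \<Rightarrow> 'v) set" where
  "ideal_generated V S = two_sided_ideal V hull S"

definition O_generators :: "'v::ab_group_add vertex_data \<Rightarrow> nat \<Rightarrow> nat \<Rightarrow> 'v set" where
  "O_generators V k l =
     {res_Y V (- int k - int l - int p - 2) (int l) u v | u v p. True}
     \<union> {Lm1 V v + L0 V v + vscale V (of_int (int l - int k)) v | v. True}"

text \<open>
  In an infinite linear combination in which each pair \<open>(k,l)\<close> occurs only finitely often, the
  entries at distinct positions are independent finite linear combinations of generators.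
\<close>

definition O_infty :: "'v::ab_group_add vertex_data \<Rightarrow> (nat \<Rightarrow> nat \<Rightarrow> 'v) set" where
  "O_infty V = {A \<in> U_infty. \<forall>k l. A k l \<in> module.span (vscale V) (O_generators V k l)}"

text \<open>Here \<open>h\<close> is the weight of \<open>v\<close>.\<close>

definition J_element ::
    "'v::ab_group_add vertex_data \<Rightarrow> nat \<Rightarrow> int \<Rightarrow> int \<Rightarrow> int \<Rightarrow> int \<Rightarrow> 'v \<Rightarrow> 'v \<Rightarrow> nat \<Rightarrow> nat \<Rightarrow> 'v" where
  "J_element V k l p n h u v =
     (\<Sum>j | n + p - int j \<ge> 0.
        mscale V ((- 1) ^ j * (of_int p gchoose j))
          (diamond V (matrix_unit v k (nat (n + p - int j)))
                     (matrix_unit u (nat (n + p - int j)) (nat (l + p)))))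
     - (\<Sum>j | l - n + int k + p - int j \<ge> 0.
        mscale V ((- 1) powi (p - int j) * (of_int p gchoose j))
          (diamond V (matrix_unit u k (nat (l - n + int k + p - int j)))
                     (matrix_unit v (nat (l - n + int k + p - int j)) (nat (l + p)))))
     - Sum_any (\<lambda>j::nat. mscale V (of_int (h + n - int k - 1) gchoose j)
          (matrix_unit (mode V v (p + int j) u) k (nat (l + p))))"

definition J_infty :: "'v::ab_group_add vertex_data \<Rightarrow> (nat \<Rightarrow> nat \<Rightarrow> 'v) set" where
  "J_infty V = module.span (mscale V)
     {J_element V k l p n h u v | k l p n h u v. l + p \<ge> 0 \<and> v \<in> vgrade V h}"

definition Omega ::
    "'v vertex_data \<Rightarrow> ('v, 'w::ab_group_add) module_data \<Rightarrow> nat \<Rightarrow> 'w set" where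
  "Omega V W n = {w. \<forall>h v k. v \<in> vgrade V h \<and> h - k - 1 < - int n \<longrightarrow> wmode W v k w = 0}"

definition Omega_pred ::
    "'v vertex_data \<Rightarrow> ('v, 'w::ab_group_add) module_data \<Rightarrow> nat \<Rightarrow> 'w set" where
  "Omega_pred V W n = (case n of 0 \<Rightarrow> {0} | Suc m \<Rightarrow> Omega V W m)"

definition gr_class ::
    "'v vertex_data \<Rightarrow> ('v, 'w::ab_group_add) module_data \<Rightarrow> nat \<Rightarrow> 'w \<Rightarrow> 'w set" where
  "gr_class V W n w = (\<lambda>z. w + z) ` Omega_pred V W n"

text \<open>An element of the direct sum is the finitely supported family of its components, each a coset.\<close>

definition Gr :: "'v vertex_data \<Rightarrow> ('v, 'w::ab_group_add) module_data \<Rightarrow> (nat \<Rightarrow> 'w set) set" where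
  "Gr V W = {g. (\<forall>n. g n \<in> gr_class V W n ` Omega V W n) \<and> finite {n. g n \<noteq> gr_class V W n 0}}"

text \<open>
  \<open>res_YW V W s v w\<close> is the coefficient of \<open>x\<close> to the power \<open>-1\<close> in \<open>x\<^sup>s Y\<^sub>W(x\<^bsup>L(0)\<^esup> v, x) w\<close>.
\<close>

definition res_YW ::
    "'v::ab_group_add vertex_data \<Rightarrow> ('v, 'w::ab_group_add) module_data \<Rightarrow> int \<Rightarrow> 'v \<Rightarrow> 'w \<Rightarrow> 'w" where
  "res_YW V W s v w = Sum_any (\<lambda>h. wmode W (component (vgrade V) h v) (s + h) w)"

text \<open>
  The component in degree \<open>k\<close> is computed on representatives \<open>w n\<close> of the nonzero cosets \<open>g n\<close>; the
  union over all representatives is that of cosets independent of the choice.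
\<close>

definition theta ::
    "'v::ab_group_add vertex_data \<Rightarrow> ('v, 'w::ab_group_add) module_data \<Rightarrow>
     (nat \<Rightarrow> nat \<Rightarrow> 'v) \<Rightarrow> (nat \<Rightarrow> 'w set) \<Rightarrow> nat \<Rightarrow> 'w set" where
  "theta V W A g = (\<lambda>k. \<Union>w \<in> {w. \<forall>n. w n \<in> g n}.
     gr_class V W k
       (\<Sum>n | g n \<noteq> gr_class V W n 0. res_YW V W (int n - int k - 1) (A k n) (w n)))"

definition theta_kernel ::
    "'v::ab_group_add vertex_data \<Rightarrow> ('v, 'w::ab_group_add) module_data \<Rightarrow>
     (nat \<Rightarrow> nat \<Rightarrow> 'v) set" where
  "theta_kernel V W = {A \<in> U_infty. \<forall>g\<in>Gr V W. theta V W A g = (\<lambda>k. gr_class V W k 0)}"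

text \<open>
  A definition cannot quantify over types, so the carrier type \<open>'w\<close> of the modules is a parameter.
  A theorem about \<open>Q_infty TYPE('w) V\<close> with \<open>'w\<close> a type variable ranges over all modules.
\<close>

definition Q_infty ::
    "'w::ab_group_add itself \<Rightarrow> 'v::ab_group_add vertex_data \<Rightarrow> (nat \<Rightarrow> nat \<Rightarrow> 'v) set" where
  "Q_infty _ V =
     {A \<in> U_infty. \<forall>W :: ('v, 'w) module_data.
        lower_bounded_generalized_module V W \<longrightarrow> A \<in> theta_kernel V W}"

end

theory Submission
  imports Defs
begin

text \<open>
  For a module \<open>W\<close> and \<open>v\<close> in \<open>V\<close>, let \<open>o\<^sub>d(v)\<close> be the operator on \<open>W\<close> that picks from each homogeneous
  component of \<open>v\<close> the mode that raises degrees by \<open>d\<close>. The matrix unit \<open>[v]\<^bsub>kl\<^esub>\<close> acts on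
  \<open>\<Omega>\<^sub>l(W)\<close> by \<open>o\<^bsub>k-l\<^esub>(v)\<close>, taken modulo \<open>\<Omega>\<^bsub>k-1\<^esub>(W)\<close>, so it lies in \<open>Q\<^sup>\<infinity>(V)\<close> as soon as
  \<open>o\<^bsub>k-l\<^esub>(v)\<close> maps \<open>\<Omega>\<^sub>l(W)\<close> into \<open>\<Omega>\<^bsub>k-1\<^esub>(W)\<close> for all \<open>W\<close>. This condition alone does not yield the one for
  \<open>[v]\<^bsub>k-1,l-1\<^esub>\<close>. The elements of the ideal satisfy a stronger one: \<open>o\<^bsub>k-l\<^esub>(v)\<close> is zero on
  \<open>\<Omega>\<^sub>l(W)\<close>. Zero on \<open>\<Omega>\<^sub>l(W)\<close> does pass to the diagonal shift, because \<open>\<Omega>\<^bsub>l-1\<^esub>(W)\<close> is contained in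
  \<open>\<Omega>\<^sub>l(W)\<close> and \<open>o\<^bsub>k-l\<^esub>\<close> depends only on the difference of \<open>k\<close> and \<open>l\<close>.

  The stronger condition holds on the ideal because the computations that relate \<open>\<diamond>\<close> to operators are
  exact on \<open>\<Omega>\<^sub>l(W)\<close>, before any passage to the quotient. On \<open>w\<close> in \<open>\<Omega>\<^sub>l(W)\<close> the Jacobi identity
  writes the action of a residue of \<open>Y((1+x)\<^bsup>L(0)\<^esup> u, x) v\<close> as a finite alternating sum of the
  vectors \<open>o\<^bsub>K-N\<^esub>(u) o\<^bsub>N-l\<^esub>(v) w\<close>, which vanish for \<open>N < 0\<close>
  (\<open>level_op_res_Y\<close>). That triangular system is inverted by a binomial transform, and the coefficients
  of the inverse are those in the definition of \<open>\<diamond>\<close>; hence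
  \<open>[u]\<^bsub>kn\<^esub> \<diamond> [v]\<^bsub>nl\<^esub>\<close> acts on \<open>\<Omega>\<^sub>l(W)\<close> as the composition \<open>o\<^bsub>k-n\<^esub>(u) o\<^bsub>n-l\<^esub>(v)\<close>
  (\<open>level_op_compose\<close>). Consequently the matrices whose entries all annihilate form a two-sided ideal.
  It contains \<open>O\<^sup>\<infinity>(V)\<close>: the residues in its definition belong to \<open>N < 0\<close>, and its other generators
  act by zero by the \<open>L(-1)\<close>-derivative property. It contains \<open>J\<^sup>\<infinity>(V)\<close>, because once each
  \<open>\<diamond>\<close>-product is replaced by a composition the defining expression becomes the Jacobi identity itself.
\<close>

section \<open>Finitely supported sums and the binomial transform\<close>

lemma additive_Sum_any:
  assumes "Modules.additive f" "finite {i. g i \<noteq> 0}"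
  shows "f (Sum_any g) = Sum_any (\<lambda>i. f (g i))"
proof -
  have "{i. f (g i) \<noteq> 0} \<subseteq> {i. g i \<noteq> 0}"
    using additive.zero[OF assms(1)] by auto
  then show ?thesis
    using assms(2) by (simp add: Sum_any.expand_set[of g] additive.sum[OF assms(1)]
        Sum_any.expand_superset[of "{i. g i \<noteq> 0}"])
qed

lemma linear_imp_additive:
  assumes "Vector_Spaces.linear s1 s2 f"
  shows "Modules.additive f"
  using assms by (simp add: Vector_Spaces.linear_iff Modules.additive_def)

text \<open>
  The form in which the truncation axioms make the series over \<open>\<nat>\<close> finite: \<open>g\<close> is the family of modes
  and \<open>f\<close> a scaled sample of it.
\<close>

lemma finite_support_of_truncation:
  fixes g :: "int \<Rightarrow> 'a::zero"
  assumes "\<exists>N. \<forall>n\<ge>N. g n = 0" and "\<And>i. g (s + int i) = 0 \<Longrightarrow> f i = 0"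
  shows "finite {i::nat. f i \<noteq> 0}"
proof -
  from assms(1) obtain N where N: "\<forall>n\<ge>N. g n = 0" ..
  have "{i. f i \<noteq> 0} \<subseteq> {..nat (N - s)}"
  proof
    fix i assume "i \<in> {i. f i \<noteq> 0}"
    with assms(2) N have "\<not> N \<le> s + int i" by blast
    then show "i \<in> {..nat (N - s)}" by simp
  qed
  then show ?thesis by (rule finite_subset) simp
qed

text \<open>
  By trinomial revision every term contains the common factor \<open>c gchoose t\<close>, and what remains is an
  alternating sum of binomial coefficients.
\<close>

lemma inverse_binomial_transform_coefficient:
  fixes c :: "'a::field_char_0"
  shows "(\<Sum>m\<le>t. (c gchoose m) * ((- 1) ^ (t - m) * ((c - of_nat m) gchoose (t - m))))
         = (if t = 0 then 1 else 0)"
proof -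
  have "(\<Sum>m\<le>t. (c gchoose m) * ((- 1) ^ (t - m) * ((c - of_nat m) gchoose (t - m))))
      = (\<Sum>m\<le>t. (c gchoose t) * ((- 1) ^ (t - m) * of_nat (t choose m)))"
  proof (rule sum.cong[OF refl])
    fix m assume "m \<in> {..t}"
    then have "(c gchoose t) * (of_nat t gchoose m) = (c gchoose m) * ((c - of_nat m) gchoose (t - m))"
      by (intro gbinomial_trinomial_revision) simp
    then show "(c gchoose m) * ((- 1) ^ (t - m) * ((c - of_nat m) gchoose (t - m)))
        = (c gchoose t) * ((- 1) ^ (t - m) * of_nat (t choose m))"
      by (simp add: binomial_gbinomial algebra_simps)
  qed
  also have "\<dots> = (c gchoose t) * (\<Sum>m\<le>t. (- 1) ^ (t - m) * of_nat (t choose m))"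
    by (simp add: sum_distrib_left)
  also have "(\<Sum>m\<le>t. (- 1) ^ (t - m) * of_nat (t choose m)) = (\<Sum>m\<le>t. (- 1) ^ m * (of_nat (t choose m) :: 'a))"
    by (rule sum.reindex_bij_witness[of _ "\<lambda>m. t - m" "\<lambda>m. t - m"])
       (auto simp: binomial_symmetric[symmetric])
  also have "(c gchoose t) * \<dots> = (if t = 0 then 1 else 0)"
    by (simp add: choose_alternating_sum)
  finally show ?thesis .
qed

text \<open>
  A unitriangular system in which the upper index of the coefficients decreases with the row: \<open>R m\<close>
  will be the action of a residue in which lowering the exponent of \<open>x\<close> by \<open>m\<close> lowers that index by \<open>m\<close>.
  Only the row \<open>m = 0\<close> contains \<open>X 0\<close>.
\<close>

lemma inverse_binomial_transform:
  fixes scale :: "'a::field_char_0 \<Rightarrow> 'b::ab_group_add \<Rightarrow> 'b"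
  assumes "vector_space scale"
    and R: "\<And>m. m \<le> N \<Longrightarrow>
      R m = (\<Sum>i\<le>N - m. scale ((- 1) ^ i * ((c - of_nat m) gchoose i)) (X (m + i)))"
  shows "(\<Sum>m\<le>N. scale (c gchoose m) (R m)) = X 0"
proof -
  interpret vector_space scale by fact
  let ?d = "\<lambda>m i. (c gchoose m) * ((- 1) ^ i * ((c - of_nat m) gchoose i))"
  have "(\<Sum>m\<le>N. scale (c gchoose m) (R m)) = (\<Sum>m\<le>N. \<Sum>i\<le>N - m. scale (?d m i) (X (m + i)))"
    by (intro sum.cong refl) (simp add: R scale_sum_right)
  also have "\<dots> = (\<Sum>(m, i)\<in>{(m, i). m + i \<le> N}. scale (?d m i) (X (m + i)))"
    by (subst sum.Sigma) (auto intro!: sum.cong)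
  also have "\<dots> = (\<Sum>t\<le>N. \<Sum>m\<le>t. scale (?d m (t - m)) (X (m + (t - m))))"
    by (rule sum.triangle_reindex_eq)
  also have "\<dots> = (\<Sum>t\<le>N. scale (\<Sum>m\<le>t. ?d m (t - m)) (X t))"
    by (intro sum.cong refl) (simp add: scale_sum_left)
  also have "\<dots> = (\<Sum>t\<le>N. if t = 0 then X 0 else 0)"
    by (intro sum.cong refl) (simp add: inverse_binomial_transform_coefficient)
  finally show ?thesis by simp
qed

section \<open>Gradings, modes and the product on matrices\<close>

lemma matrix_unit_in_U_infty: "matrix_unit v k l \<in> U_infty"
proof -
  have "finite {i. matrix_unit v k l i j \<noteq> 0}" for j
    by (rule finite_subset[of _ "{k}"]) (auto simp: matrix_unit_def)
  then show ?thesis by (simp add: U_infty_def)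
qed

lemma matrix_unit_additive: "Modules.additive (\<lambda>v. matrix_unit v k l)"
  by (simp add: Modules.additive_def matrix_unit_def fun_eq_iff)

context grading_restricted_vertex_algebra
begin

interpretation vs: vector_space "vscale V" by (rule carrier_vector_space)

lemma component_eqI: "decomposes (vgrade V) v f \<Longrightarrow> component (vgrade V) h v = f h"
  unfolding component_def using grading unfolding internal_direct_sum_def
  by (metis the1_equality)

lemma subspace_grade: "vs.subspace (vgrade V h)"
  using grading by (simp add: internal_direct_sum_def)

lemma decomposes_component: "decomposes (vgrade V) v (\<lambda>h. component (vgrade V) h v)"
proof -
  obtain f where f: "decomposes (vgrade V) v f"
    using grading unfolding internal_direct_sum_def by metis
  then have "(\<lambda>h. component (vgrade V) h v) = f" by (auto simp: component_eqI)
  with f show ?thesis by simp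
qed

lemma component_in_grade: "component (vgrade V) h v \<in> vgrade V h"
  using decomposes_component by (simp add: decomposes_def)

lemma finite_components: "finite {h. component (vgrade V) h v \<noteq> 0}"
  using decomposes_component by (simp add: decomposes_def)

lemma Sum_any_components: "Sum_any (\<lambda>h. component (vgrade V) h v) = v"
  using decomposes_component[of v] by (simp add: decomposes_def Sum_any.expand_set)

lemma decomposesI:
  assumes "\<And>h. f h \<in> vgrade V h" "finite A" "{h. f h \<noteq> 0} \<subseteq> A" "v = sum f A"
  shows "decomposes (vgrade V) v f"
  using assms by (auto simp: decomposes_def finite_subset intro: sum.mono_neutral_right)

lemma component_homogeneous:
  assumes "v \<in> vgrade V h"
  shows "component (vgrade V) h' v = (if h' = h then v else 0)"
  by (rule component_eqI, rule decomposesI[of _ "{h}"])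
     (use assms vs.subspace_0[OF subspace_grade] in auto)

lemma component_add:
  "component (vgrade V) h (u + v) = component (vgrade V) h u + component (vgrade V) h v"
proof (rule component_eqI, rule decomposesI)
  let ?A = "{h. component (vgrade V) h u \<noteq> 0} \<union> {h. component (vgrade V) h v \<noteq> 0}"
  show "finite ?A" by (simp add: finite_components)
  have "w = (\<Sum>h\<in>?A. component (vgrade V) h w)" if "w = u \<or> w = v" for w
    by (subst Sum_any_components[symmetric], rule Sum_any.expand_superset)
       (use that finite_components in auto)
  then show "u + v = (\<Sum>h\<in>?A. component (vgrade V) h u + component (vgrade V) h v)"
    unfolding sum.distrib by simp
qed (auto simp: component_in_grade vs.subspace_add subspace_grade)

lemma component_scale:
  "component (vgrade V) h (vscale V c v) = vscale V c (component (vgrade V) h v)"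
proof (rule component_eqI, rule decomposesI[OF _ finite_components[of v]])
  show "vscale V c v = (\<Sum>h | component (vgrade V) h v \<noteq> 0. vscale V c (component (vgrade V) h v))"
    using Sum_any_components[of v] by (simp add: Sum_any.expand_set flip: vs.scale_sum_right)
qed (auto simp: component_in_grade vs.subspace_scale subspace_grade)

lemma component_zero [simp]: "component (vgrade V) h 0 = 0"
  using component_scale[of h 0 0] by simp

text \<open>
  Reduces an identity that is additive in \<open>v\<close> to homogeneous \<open>v\<close>, where the modes have definite weight.
\<close>

lemma homogeneous_induct [case_names homogeneous add]:
  assumes "\<And>h v. v \<in> vgrade V h \<Longrightarrow> P v" and add: "\<And>u v. P u \<Longrightarrow> P v \<Longrightarrow> P (u + v)"
  shows "P v"
proof -
  have 0: "P 0" using assms(1) vs.subspace_0[OF subspace_grade] by blast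
  have "P (\<Sum>h\<in>A. component (vgrade V) h v)" if "finite A" for A
    using that by induction (auto intro: assms component_in_grade 0)
  then show ?thesis
    using Sum_any_components[of v] finite_components[of v] by (metis Sum_any.expand_set)
qed

lemma mode_add_left: "mode V (u + v) n w = mode V u n w + mode V v n w"
  and mode_scale_left: "mode V (vscale V c v) n w = vscale V c (mode V v n w)"
  using mode_linear_left by (simp_all add: Vector_Spaces.linear_iff)

lemma mode_add_right: "mode V v n (w + w') = mode V v n w + mode V v n w'"
  and mode_scale_right: "mode V v n (vscale V c w) = vscale V c (mode V v n w)"
  using mode_linear_right by (simp_all add: Vector_Spaces.linear_iff)

lemma mode_zero_left [simp]: "mode V 0 n w = 0"
  using mode_scale_left[of 0 0] by simp

lemma mode_zero_right [simp]: "mode V v n 0 = 0"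
  using mode_scale_right[of _ _ 0 0] by simp

lemma Lm1_add: "Lm1 V (u + v) = Lm1 V u + Lm1 V v"
  by (simp add: Lm1_def mode_add_left)

lemma L0_add: "L0 V (u + v) = L0 V u + L0 V v"
proof -
  have "finite {n. vscale V (of_int n) (component (vgrade V) n v) \<noteq> 0}" for v
    by (rule finite_subset[OF _ finite_components[of v]]) auto
  then show ?thesis
    by (simp add: L0_def component_add vs.scale_right_distrib Sum_any.distrib)
qed

lemma L0_homogeneous:
  assumes "v \<in> vgrade V h"
  shows "L0 V v = vscale V (of_int h) v"
proof -
  have "L0 V v = (\<Sum>n\<in>{h}. vscale V (of_int n) (component (vgrade V) n v))"
    unfolding L0_def
    by (rule Sum_any.expand_superset) (auto simp: component_homogeneous[OF assms])
  then show ?thesis by (simp add: component_homogeneous[OF assms])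
qed

lemma component_L0: "component (vgrade V) h (L0 V v) = vscale V (of_int h) (component (vgrade V) h v)"
proof (rule component_eqI, rule decomposesI[OF _ finite_components[of v]])
  show "L0 V v = (\<Sum>h | component (vgrade V) h v \<noteq> 0. vscale V (of_int h) (component (vgrade V) h v))"
    unfolding L0_def by (rule Sum_any.expand_superset) (auto simp: finite_components)
qed (auto simp: component_in_grade vs.subspace_scale subspace_grade)

text \<open>
  The components of \<open>v\<close> are \<open>L(0)\<close>-eigenvectors for distinct eigenvalues, so only one survives.
\<close>

lemma grade_of_L0_eigenvector:
  assumes "L0 V v = vscale V (of_int h) v"
  shows "v \<in> vgrade V h"
proof -
  have "component (vgrade V) n v = 0" if "n \<noteq> h" for n
  proof -
    have "vscale V (of_int n) (component (vgrade V) n v) = vscale V (of_int h) (component (vgrade V) n v)"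
      by (metis assms component_L0 component_scale)
    with that show ?thesis by (simp add: vs.scale_cancel_right)
  qed
  then have "Sum_any (\<lambda>n. component (vgrade V) n v) = sum (\<lambda>n. component (vgrade V) n v) {h}"
    by (intro Sum_any.expand_superset) auto
  then show ?thesis using component_in_grade[of h v] by (simp add: Sum_any_components)
qed

lemma mode_weight:
  assumes "u \<in> vgrade V h" "v \<in> vgrade V g"
  shows "mode V u n v \<in> vgrade V (h + g - n - 1)"
proof (rule grade_of_L0_eigenvector)
  show "L0 V (mode V u n v) = vscale V (of_int (h + g - n - 1)) (mode V u n v)"
    using L0_bracket[of u n v]
    by (simp add: L0_homogeneous[OF assms(1)] L0_homogeneous[OF assms(2)] mode_scale_left
        mode_scale_right vs.scale_left_distrib vs.scale_left_diff_distrib algebra_simps)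
qed

lemma Lm1_weight: "v \<in> vgrade V h \<Longrightarrow> Lm1 V v \<in> vgrade V (h + 1)"
  unfolding Lm1_def using mode_weight[OF _ vacuum_weight, of v h "- 2"] by (simp add: add.commute)

lemma res_Y_homogeneous:
  assumes "u \<in> vgrade V h"
  shows "res_Y V s l u v = Sum_any (\<lambda>i::nat. vscale V (of_int (l + h) gchoose i) (mode V u (s + int i) v))"
proof -
  have "res_Y V s l u v = (\<Sum>h'\<in>{h}. Sum_any (\<lambda>i::nat.
       vscale V (of_int (l + h') gchoose i) (mode V (component (vgrade V) h' u) (s + int i) v)))"
    unfolding res_Y_def
    by (rule Sum_any.expand_superset) (auto simp: component_homogeneous[OF assms])
  then show ?thesis by (simp add: component_homogeneous[OF assms])
qed

lemma finite_mode_support: "finite {i::nat. vscale V (c i) (mode V u (s + int i) v) \<noteq> 0}"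
  by (rule finite_support_of_truncation[OF truncation[of u v], where s = s]) simp

lemma res_Y_outer_finite:
  "finite {h. Sum_any (\<lambda>i::nat. vscale V (of_int (l + h) gchoose i)
      (mode V (component (vgrade V) h u) (s + int i) v)) \<noteq> 0}"
  by (rule finite_subset[OF _ finite_components[of u]]) auto

lemma res_Y_add_left: "res_Y V s l (u + u') v = res_Y V s l u v + res_Y V s l u' v"
  unfolding res_Y_def component_add mode_add_left vs.scale_right_distrib
  by (subst Sum_any.distrib[OF finite_mode_support finite_mode_support])
     (rule Sum_any.distrib[OF res_Y_outer_finite res_Y_outer_finite])

lemma res_Y_add_right: "res_Y V s l u (v + v') = res_Y V s l u v + res_Y V s l u v'"
  unfolding res_Y_def mode_add_right vs.scale_right_distrib
  by (subst Sum_any.distrib[OF finite_mode_support finite_mode_support])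
     (rule Sum_any.distrib[OF res_Y_outer_finite res_Y_outer_finite])

lemma res_Y_zero_left [simp]: "res_Y V s l 0 v = 0"
  by (simp add: res_Y_def)

lemma res_Y_zero_right [simp]: "res_Y V s l u 0 = 0"
  by (simp add: res_Y_def)

lemma diamond_entry_zero_left [simp]: "diamond_entry V k n l 0 v = 0"
  and diamond_entry_zero_right [simp]: "diamond_entry V k n l u 0 = 0"
  by (simp_all add: diamond_entry_def)

lemma diamond_entry_add_left:
  "diamond_entry V k n l (u + u') v = diamond_entry V k n l u v + diamond_entry V k n l u' v"
  and diamond_entry_add_right:
  "diamond_entry V k n l u (v + v') = diamond_entry V k n l u v + diamond_entry V k n l u v'"
  by (simp_all add: diamond_entry_def res_Y_add_left res_Y_add_right vs.scale_right_distrib sum.distrib)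

lemma diamond_in_U_infty:
  assumes A: "A \<in> U_infty" and B: "B \<in> U_infty"
  shows "diamond V A B \<in> U_infty"
  unfolding U_infty_def
proof (clarify)
  fix l
  have "{k. diamond V A B k l \<noteq> 0} \<subseteq> (\<Union>n\<in>{n. B n l \<noteq> 0}. {k. A k n \<noteq> 0})"
  proof
    fix k assume "k \<in> {k. diamond V A B k l \<noteq> 0}"
    then obtain n where "B n l \<noteq> 0" "diamond_entry V k n l (A k n) (B n l) \<noteq> 0"
      unfolding diamond_def by (auto elim: sum.not_neutral_contains_not_neutral)
    then show "k \<in> (\<Union>n\<in>{n. B n l \<noteq> 0}. {k. A k n \<noteq> 0})" by auto
  qed
  moreover have "finite (\<Union>n\<in>{n. B n l \<noteq> 0}. {k. A k n \<noteq> 0})"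
    using A B by (auto simp: U_infty_def)
  ultimately show "finite {k. diamond V A B k l \<noteq> 0}" by (rule finite_subset)
qed

lemma diamond_matrix_unit:
  "diamond V (matrix_unit u k n) (matrix_unit v n l) = matrix_unit (diamond_entry V k n l u v) k l"
proof (intro ext)
  fix i j
  have "diamond V (matrix_unit u k n) (matrix_unit v n l) i j
    = (\<Sum>n'\<in>{n}. diamond_entry V i n' j (matrix_unit u k n i n') (matrix_unit v n l n' j))"
    unfolding diamond_def
    by (rule sum.mono_neutral_left) (auto simp: matrix_unit_def)
  then show "diamond V (matrix_unit u k n) (matrix_unit v n l) i j
    = matrix_unit (diamond_entry V k n l u v) k l i j"
    by (simp add: matrix_unit_def)
qed

lemma module_mscale: "module (mscale V)"
  by unfold_locales
    (auto simp: mscale_def fun_eq_iff vs.scale_right_distrib vs.scale_left_distrib)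

lemma mscale_matrix_unit: "mscale V c (matrix_unit v k l) = matrix_unit (vscale V c v) k l"
  by (simp add: mscale_def matrix_unit_def fun_eq_iff)

text \<open>
  The vector at position \<open>(k, L)\<close> of a generator of \<open>J\<^sup>\<infinity>(V)\<close>, all of whose other entries vanish; \<open>L\<close> is
  the column \<open>l + p\<close>.
\<close>

definition J_entry :: "nat \<Rightarrow> nat \<Rightarrow> int \<Rightarrow> int \<Rightarrow> int \<Rightarrow> 'v \<Rightarrow> 'v \<Rightarrow> 'v" where
  "J_entry k L p n h u v =
     (\<Sum>j | n + p - int j \<ge> 0. vscale V ((- 1) ^ j * (of_int p gchoose j))
        (diamond_entry V k (nat (n + p - int j)) L v u))
   - (\<Sum>j | int L - n + int k - int j \<ge> 0. vscale V ((- 1) powi (p - int j) * (of_int p gchoose j))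
        (diamond_entry V k (nat (int L - n + int k - int j)) L u v))
   - Sum_any (\<lambda>j::nat. vscale V (of_int (h + n - int k - 1) gchoose j) (mode V v (p + int j) u))"

lemma J_element_eq_matrix_unit:
  assumes "l + p = int L"
  shows "J_element V k l p n h u v = matrix_unit (J_entry k L p n h u v) k L"
proof -
  have "l - n + int k + p - int j = int L - n + int k - int j" for j
    using assms by simp
  then show ?thesis
    unfolding J_element_def J_entry_def
    by (simp only: assms nat_int diamond_matrix_unit mscale_matrix_unit
        additive.diff[OF matrix_unit_additive] additive.sum[OF matrix_unit_additive]
        additive_Sum_any[OF matrix_unit_additive finite_mode_support])
qed

lemma J_entry_add:
  "J_entry k L p n h (u + u') v = J_entry k L p n h u v + J_entry k L p n h u' v"
  unfolding J_entry_def mode_add_right vs.scale_right_distrib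
    Sum_any.distrib[OF finite_mode_support finite_mode_support]
  by (simp add: diamond_entry_add_left diamond_entry_add_right vs.scale_right_distrib sum.distrib)

end

section \<open>Operators between levels of a module\<close>

context lower_bounded_generalized_module
begin

interpretation vs: vector_space "vscale V" by (rule carrier_vector_space)
interpretation ws: vector_space "wscale W" by (rule module_vector_space)

lemma wmode_add_left: "wmode W (u + v) n w = wmode W u n w + wmode W v n w"
  and wmode_scale_left: "wmode W (vscale V c v) n w = wscale W c (wmode W v n w)"
  using wmode_linear_left by (simp_all add: Vector_Spaces.linear_iff)

lemma wmode_add_right: "wmode W v n (w + w') = wmode W v n w + wmode W v n w'"
  using wmode_linear_right by (simp_all add: Vector_Spaces.linear_iff)

lemma wmode_zero_left [simp]: "wmode W 0 n w = 0"
  using wmode_scale_left[of 0 0] by simp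

lemma wmode_zero_right [simp]: "wmode W v n 0 = 0"
  using wmode_add_right[of v n 0 0] by simp

text \<open>
  The operator \<open>o\<^bsub>i-j\<^esub>(v)\<close>. It depends only on \<open>i - j\<close>; recording both indices, as for the matrix unit
  \<open>[v]\<^bsub>ij\<^esub>\<close>, makes compositions read like matrix products. The indices are integers so that levels below
  zero make sense.
\<close>

definition level_op :: "int \<Rightarrow> int \<Rightarrow> 'v \<Rightarrow> 'w \<Rightarrow> 'w" where
  "level_op i j v w = res_YW V W (j - i - 1) v w"

lemma level_op_homogeneous:
  assumes "v \<in> vgrade V h"
  shows "level_op i j v w = wmode W v (h + j - i - 1) w"
proof -
  have "level_op i j v w = (\<Sum>h'\<in>{h}. wmode W (component (vgrade V) h' v) (j - i - 1 + h') w)"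
    unfolding level_op_def res_YW_def
    by (rule Sum_any.expand_superset) (auto simp: component_homogeneous[OF assms])
  then show ?thesis by (simp add: component_homogeneous[OF assms] algebra_simps)
qed

lemma finite_wmode_components:
  "finite {h. wmode W (component (vgrade V) h v) (s + h) w \<noteq> 0}"
  by (rule finite_subset[OF _ finite_components[of v]]) auto

lemma level_op_add_left: "level_op i j (u + v) w = level_op i j u w + level_op i j v w"
  unfolding level_op_def res_YW_def component_add wmode_add_left
  by (rule Sum_any.distrib[OF finite_wmode_components finite_wmode_components])

lemma level_op_add_right: "level_op i j v (w + w') = level_op i j v w + level_op i j v w'"
  unfolding level_op_def res_YW_def wmode_add_right
  by (rule Sum_any.distrib[OF finite_wmode_components finite_wmode_components])

lemma level_op_scale_left: "level_op i j (vscale V c v) w = wscale W c (level_op i j v w)"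
proof (induction v rule: homogeneous_induct)
  case (homogeneous h v)
  then have "vscale V c v \<in> vgrade V h" by (simp add: vs.subspace_scale subspace_grade)
  with homogeneous show ?case by (simp add: level_op_homogeneous wmode_scale_left)
qed (simp add: vs.scale_right_distrib ws.scale_right_distrib level_op_add_left)

lemma level_op_linear: "Vector_Spaces.linear (vscale V) (wscale W) (\<lambda>v. level_op i j v w)"
  by (simp add: Vector_Spaces.linear_iff carrier_vector_space module_vector_space
      level_op_add_left level_op_scale_left)

lemma level_op_zero_left [simp]: "level_op i j 0 w = 0"
  using level_op_scale_left[of i j 0 0] by simp

lemma level_op_zero_right [simp]: "level_op i j v 0 = 0"
  using level_op_add_right[of i j v 0 0] by simp

lemma level_op_diff_left: "level_op i j (u - v) w = level_op i j u w - level_op i j v w"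
  using level_op_add_left[of i j "u - v" v w] by simp

lemma level_op_sum_left: "level_op i j (sum f A) w = (\<Sum>a\<in>A. level_op i j (f a) w)"
  using additive.sum[OF linear_imp_additive[OF level_op_linear]] .

lemma level_op_Sum_any_left:
  "finite {a. f a \<noteq> 0} \<Longrightarrow> level_op i j (Sum_any f) w = Sum_any (\<lambda>a. level_op i j (f a) w)"
  using additive_Sum_any[OF linear_imp_additive[OF level_op_linear]] .

lemma OmegaI:
  "(\<And>h v k. v \<in> vgrade V h \<Longrightarrow> h - k - 1 < - int n \<Longrightarrow> wmode W v k w = 0) \<Longrightarrow> w \<in> Omega V W n"
  by (auto simp: Omega_def)

lemma OmegaD:
  "w \<in> Omega V W n \<Longrightarrow> v \<in> vgrade V h \<Longrightarrow> h - k - 1 < - int n \<Longrightarrow> wmode W v k w = 0"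
  unfolding Omega_def by blast

text \<open>
  \<open>\<Omega>\<^sub>n(W)\<close> consists of the vectors that, placed at level \<open>n\<close>, cannot be moved below level zero.
\<close>

lemma Omega_iff_level_op:
  "w \<in> Omega V W n \<longleftrightarrow> (\<forall>i<0. \<forall>v. level_op i (int n) v w = 0)"
proof (intro iffI allI impI)
  fix i :: int and v assume "w \<in> Omega V W n" "i < 0"
  then show "level_op i (int n) v w = 0"
    by (induction v rule: homogeneous_induct)
       (simp_all add: level_op_homogeneous level_op_add_left OmegaD)
next
  assume *: "\<forall>i<0. \<forall>v. level_op i (int n) v w = 0"
  show "w \<in> Omega V W n"
  proof (rule OmegaI)
    fix h v k assume "v \<in> vgrade V h" "h - k - 1 < - int n"
    with *[rule_format, of "h + int n - k - 1" v] show "wmode W v k w = 0"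
      by (simp add: level_op_homogeneous)
  qed
qed

lemma level_op_negative:
  "w \<in> Omega V W n \<Longrightarrow> i < 0 \<Longrightarrow> level_op i (int n) v w = 0"
  by (simp add: Omega_iff_level_op)

lemma zero_in_Omega: "0 \<in> Omega V W n"
  by (simp add: Omega_iff_level_op)

lemma Omega_add: "w \<in> Omega V W n \<Longrightarrow> w' \<in> Omega V W n \<Longrightarrow> w + w' \<in> Omega V W n"
  by (simp add: Omega_iff_level_op level_op_add_right)

lemma Omega_mono: "m \<le> n \<Longrightarrow> Omega V W m \<subseteq> Omega V W n"
  by (auto intro!: OmegaI elim!: OmegaD)

lemma Omega_pred_subset: "Omega_pred V W n \<subseteq> Omega V W n"
  using Omega_mono[of "n - 1" n] by (auto simp: Omega_pred_def zero_in_Omega split: nat.splits)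

lemma zero_in_Omega_pred: "0 \<in> Omega_pred V W n"
  by (simp add: Omega_pred_def zero_in_Omega split: nat.split)

section \<open>Residues and products act exactly on \<open>\<Omega>\<^sub>l(W)\<close>\<close>

text \<open>
  This is the Jacobi identity for \<open>u\<close>, \<open>v\<close> whose parameter \<open>m\<close> is \<open>l + wt u\<close>, the exponent of
  \<open>1 + x\<close>. For that choice the modes of \<open>u\<close> in the second sum on the right move \<open>w\<close> below level
  zero, so the whole sum is absent, and the first sum stops as soon as the mode of \<open>v\<close> does the same,
  that is when \<open>N - i < 0\<close>. For \<open>N < 0\<close> nothing is left.
\<close>

lemma level_op_res_Y:
  assumes w: "w \<in> Omega V W l"
  shows "level_op K (int l) (res_Y V (N - K - int l - 1) (int l) u v) w
    = (\<Sum>i<nat (N + 1). wscale W ((- 1) ^ i * (of_int (N - K - int l - 1) gchoose i))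
         (level_op K (N - int i) u (level_op (N - int i) (int l) v w)))"
proof (induction u rule: homogeneous_induct)
  case u: (homogeneous h u)
  show ?case
  proof (induction v rule: homogeneous_induct)
    case v: (homogeneous g v)
    define s where "s = N - K - int l - 1"
    (* chosen so that the modes on the left of the Jacobi identity lead from level l to level K *)
    define n where "n = g - s - K - 2"
    have second: "wmode W u (int l + h + int i) w = 0" for i
      (* these modes lead from level l to level - 1 - i *)
      using w[unfolded Omega_iff_level_op, rule_format, of "- 1 - int i" u]
      by (simp add: level_op_homogeneous[OF u] algebra_simps)
    have "level_op K (int l) (res_Y V s (int l) u v) w
        = Sum_any (\<lambda>i::nat. wscale W (of_int (int l + h) gchoose i)
             (level_op K (int l) (mode V u (s + int i) v) w))"
      unfolding res_Y_homogeneous[OF u] level_op_Sum_any_left[OF finite_mode_support]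
      by (simp add: level_op_scale_left)
    also have "\<dots> = Sum_any (\<lambda>i::nat. wscale W (of_int (int l + h) gchoose i)
           (wmode W (mode V u (s + int i) v) (int l + h + n - int i) w))"
      by (simp add: level_op_homogeneous[OF mode_weight[OF u v]] n_def algebra_simps)
    also have "\<dots> = Sum_any (\<lambda>i::nat. wscale W ((- 1) ^ i * (of_int s gchoose i))
           (wmode W u (int l + h + s - int i) (wmode W v (n + int i) w)))"
      unfolding module_jacobi second by simp
    also have "\<dots> = Sum_any (\<lambda>i::nat. wscale W ((- 1) ^ i * (of_int s gchoose i))
           (level_op K (N - int i) u (level_op (N - int i) (int l) v w)))"
      by (simp add: level_op_homogeneous[OF u] level_op_homogeneous[OF v] s_def n_def algebra_simps)
    also have "\<dots> = (\<Sum>i<nat (N + 1). wscale W ((- 1) ^ i * (of_int s gchoose i))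
           (level_op K (N - int i) u (level_op (N - int i) (int l) v w)))"
    proof (rule Sum_any.expand_superset)
      have "level_op (N - int i) (int l) v w = 0" if "i \<notin> {..<nat (N + 1)}" for i
        using that by (intro level_op_negative[OF w]) simp
      then show "{i. wscale W ((- 1) ^ i * (of_int s gchoose i))
           (level_op K (N - int i) u (level_op (N - int i) (int l) v w)) \<noteq> 0} \<subseteq> {..<nat (N + 1)}"
        by force
    qed simp
    finally show ?case by (simp add: s_def)
  qed (simp add: res_Y_add_right level_op_add_left level_op_add_right ws.scale_right_distrib sum.distrib)
qed (simp add: res_Y_add_left level_op_add_left ws.scale_right_distrib sum.distrib)

text \<open>
  For \<open>N, N - 1, \<dots>, 0\<close> the preceding lemma is a unitriangular system for the vectors
  \<open>o\<^bsub>K-N\<^esub>(u) o\<^bsub>N-l\<^esub>(v) w\<close>, and the binomial transform solves it. For \<open>K \<ge> 0\<close> the sum on the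
  right is the product \<open>\<diamond>\<close>; negative \<open>K\<close> serve to show that \<open>o\<^bsub>N-l\<^esub>(v) w\<close> cannot be moved below
  level zero.
\<close>

lemma level_op_compose:
  assumes w: "w \<in> Omega V W l"
  shows "level_op K (int N) u (level_op (int N) (int l) v w)
    = level_op K (int l) (\<Sum>m = 0..N. vscale V (of_int (- K + int N - int l - 1) gchoose m)
        (res_Y V (- K + int N - int l - int m - 1) (int l) u v)) w"
proof -
  define c :: complex where "c = of_int (- K + int N - int l - 1)"
  define R where "R m = level_op K (int l) (res_Y V (- K + int N - int l - int m - 1) (int l) u v) w" for m
  define X where "X t = level_op K (int N - int t) u (level_op (int N - int t) (int l) v w)" for t
  have "R m = (\<Sum>i\<le>N - m. wscale W ((- 1) ^ i * ((c - of_nat m) gchoose i)) (X (m + i)))"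
    if "m \<le> N" for m
  proof -
    have "{..<nat (int N - int m + 1)} = {..N - m}"
      using that by auto
    moreover have "- K + int N - int l - int m - 1 = (int N - int m) - K - int l - 1" by simp
    moreover have "of_int (int N - int m - K - int l - 1) = c - of_nat m" by (simp add: c_def)
    ultimately show ?thesis
      unfolding R_def X_def by (simp only: level_op_res_Y[OF w]) (simp add: algebra_simps)
  qed
  from inverse_binomial_transform[OF module_vector_space, of N R c X, OF this]
  have "(\<Sum>m\<le>N. wscale W (c gchoose m) (R m)) = X 0" by simp
  then show ?thesis
    by (simp add: level_op_sum_left level_op_scale_left R_def X_def c_def atLeast0AtMost)
qed

lemma level_op_diamond_entry:
  "w \<in> Omega V W l \<Longrightarrow> level_op (int k) (int l) (diamond_entry V k n l u v) w
    = level_op (int k) (int n) u (level_op (int n) (int l) v w)"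
  by (simp add: level_op_compose diamond_entry_def)

lemma level_op_Omega:
  assumes w: "w \<in> Omega V W l"
  shows "level_op (int n) (int l) v w \<in> Omega V W n"
  using w by (simp add: Omega_iff_level_op level_op_compose[OF w])

section \<open>The ideal of annihilating matrices\<close>

definition annihilator :: "nat \<Rightarrow> nat \<Rightarrow> 'v set" where
  "annihilator k l = {v. \<forall>w\<in>Omega V W l. level_op (int k) (int l) v w = 0}"

lemma subspace_annihilator: "vs.subspace (annihilator k l)"
  by (rule vs.subspaceI) (auto simp: annihilator_def level_op_add_left level_op_scale_left)

text \<open>
  The residues are those of \<open>level_op_res_Y\<close> with \<open>N = - p - 1 < 0\<close>. For the other generators, with \<open>v\<close> of weight \<open>h\<close>, the
  derivative property turns the mode of \<open>L(-1)v\<close> into \<open>-(h + l - k)\<close> times the mode of \<open>v\<close> of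
  the same degree, which cancels the contribution of \<open>(L(0) + l - k)v\<close>.
\<close>

lemma O_generators_annihilate: "O_generators V k l \<subseteq> annihilator k l"
proof -
  have "res_Y V (- int k - int l - int p - 2) (int l) u v \<in> annihilator k l" for u v p
  proof -
    have "- int p - 1 - int k - int l - 1 = - int k - int l - int p - 2" by simp
    with level_op_res_Y[of _ l "int k" "- int p - 1" u v] show ?thesis
      by (simp only: annihilator_def mem_Collect_eq) simp
  qed
  moreover have "Lm1 V v + L0 V v + vscale V (of_int (int l - int k)) v \<in> annihilator k l" for v
  proof -
    have "level_op k l (Lm1 V v + L0 V v + vscale V (of_int (int l - int k)) v) w = 0" for w
    proof (induction v rule: homogeneous_induct)
      case (homogeneous h v)
      obtain LWm1 where "\<And>u n w. wmode W (Lm1 V u) n w = wscale W (of_int (- n)) (wmode W u (n - 1) w)"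
        using module_Lm1 by blast
      with homogeneous show ?case
        by (simp add: level_op_add_left level_op_scale_left L0_homogeneous
            level_op_homogeneous[OF Lm1_weight] level_op_homogeneous)
          (simp add: ws.scale_left_distrib ws.scale_left_diff_distrib algebra_simps)
    next
      case (add u v)
      have "level_op k l (Lm1 V (u + v) + L0 V (u + v) + vscale V (of_int (int l - int k)) (u + v)) w
        = level_op k l (Lm1 V u + L0 V u + vscale V (of_int (int l - int k)) u) w
        + level_op k l (Lm1 V v + L0 V v + vscale V (of_int (int l - int k)) v) w"
        by (simp add: Lm1_add L0_add vs.scale_right_distrib level_op_add_left)
      with add show ?case by simp
    qed
    then show ?thesis by (simp add: annihilator_def)
  qed
  ultimately show ?thesis by (auto simp: O_generators_def)
qed

text \<open>
  The intermediate index of a matrix product must be a natural number, whereas the Jacobi identity sums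
  over all \<open>j\<close>. The additional terms pass through a negative level and therefore vanish.
\<close>

lemma Sum_any_level_op_compose:
  assumes w: "w \<in> Omega V W l"
  shows "level_op (int k) (int l) (\<Sum>j | r - int j \<ge> 0. vscale V (c j)
        (diamond_entry V k (nat (r - int j)) l u v)) w
    = Sum_any (\<lambda>j. wscale W (c j) (level_op (int k) (r - int j) u (level_op (r - int j) (int l) v w)))"
proof -
  have "{j. r - int j \<ge> 0} \<subseteq> {..nat r}" by auto
  then have fin: "finite {j. r - int j \<ge> 0}" by (rule finite_subset) simp
  have "level_op (r - int j) (int l) v w = 0" if "j \<notin> {j. r - int j \<ge> 0}" for j
    using that by (intro level_op_negative[OF w]) simp
  then have "{j. wscale W (c j) (level_op (int k) (r - int j) u (level_op (r - int j) (int l) v w)) \<noteq> 0}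
      \<subseteq> {j. r - int j \<ge> 0}"
    by force
  with fin have "Sum_any (\<lambda>j. wscale W (c j) (level_op (int k) (r - int j) u (level_op (r - int j) (int l) v w)))
    = (\<Sum>j | r - int j \<ge> 0. wscale W (c j)
        (level_op (int k) (r - int j) u (level_op (r - int j) (int l) v w)))"
    by (rule Sum_any.expand_superset)
  then show ?thesis
    by (simp add: level_op_sum_left level_op_scale_left level_op_diamond_entry[OF w])
qed

text \<open>
  With compositions in place of \<open>\<diamond>\<close>-products this is the Jacobi identity for \<open>v\<close>, \<open>u\<close> whose exponent
  \<open>l\<close> is \<open>p\<close> and whose mode indices \<open>m\<close>, \<open>n\<close> are the numbers \<open>m\<close>, \<open>q\<close> of the proof.
\<close>

lemma J_entry_annihilates:
  assumes v: "v \<in> vgrade V h"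
  shows "J_entry k L p n h u v \<in> annihilator k L"
proof -
  have "level_op (int k) (int L) (J_entry k L p n h u v) w = 0" if w: "w \<in> Omega V W L" for w
  proof (induction u rule: homogeneous_induct)
    case u: (homogeneous g u)
    define m where "m = h + n - int k - 1"
    define q where "q = g - 1 - n + int L - p"
    have sign: "(- 1 :: complex) powi (p - int j) = (- 1) powi (p + int j)" for j
      by (simp add: power_int_minus_left)
    have "level_op (int k) (int L) (J_entry k L p n h u v) w
      = Sum_any (\<lambda>j. wscale W ((- 1) ^ j * (of_int p gchoose j))
          (wmode W v (m + p - int j) (wmode W u (q + int j) w)))
      - Sum_any (\<lambda>j. wscale W ((- 1) powi (p + int j) * (of_int p gchoose j))
          (wmode W u (q + p - int j) (wmode W v (m + int j) w)))
      - Sum_any (\<lambda>j. wscale W (of_int m gchoose j)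
          (wmode W (mode V v (p + int j) u) (m + q - int j) w))"
      unfolding J_entry_def level_op_diff_left Sum_any_level_op_compose[OF w]
        level_op_Sum_any_left[OF finite_mode_support] level_op_scale_left sign
        level_op_homogeneous[OF v] level_op_homogeneous[OF u] level_op_homogeneous[OF mode_weight[OF v u]]
      by (simp add: m_def q_def algebra_simps)
    also have "\<dots> = 0"
      using module_jacobi[of m v p u q w] by simp
    finally show ?case .
  qed (simp add: J_entry_add level_op_add_left)
  then show ?thesis by (simp add: annihilator_def)
qed

definition annihilating_matrices :: "(nat \<Rightarrow> nat \<Rightarrow> 'v) set" where
  "annihilating_matrices = {A \<in> U_infty. \<forall>k l. A k l \<in> annihilator k l}"

text \<open>
  If \<open>v\<close> annihilates, the composition vanishes at once; if \<open>u\<close> does, it is applied to a vector of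
  \<open>\<Omega>\<^sub>n(W)\<close>, since \<open>o\<^bsub>n-l\<^esub>(v)\<close> maps \<open>\<Omega>\<^sub>l(W)\<close> into \<open>\<Omega>\<^sub>n(W)\<close>.
\<close>

lemma diamond_entry_annihilates:
  "u \<in> annihilator k n \<or> v \<in> annihilator n l \<Longrightarrow> diamond_entry V k n l u v \<in> annihilator k l"
  by (auto simp: annihilator_def level_op_diamond_entry level_op_Omega)

lemma two_sided_ideal_annihilating_matrices: "two_sided_ideal V annihilating_matrices"
  unfolding two_sided_ideal_def
proof (intro conjI ballI)
  show "module.subspace (mscale V) annihilating_matrices"
  proof (rule module.subspaceI[OF module_mscale])
    show "0 \<in> annihilating_matrices"
      by (simp add: annihilating_matrices_def U_infty_def vs.subspace_0 subspace_annihilator)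
  next
    fix A B assume AB: "A \<in> annihilating_matrices" "B \<in> annihilating_matrices"
    have "finite {k. A k l + B k l \<noteq> 0}" for l
      by (rule finite_subset[of _ "{k. A k l \<noteq> 0} \<union> {k. B k l \<noteq> 0}"])
         (use AB in \<open>auto simp: annihilating_matrices_def U_infty_def\<close>)
    with AB show "A + B \<in> annihilating_matrices"
      by (simp add: annihilating_matrices_def U_infty_def vs.subspace_add subspace_annihilator)
  next
    fix c A assume A: "A \<in> annihilating_matrices"
    have "finite {k. vscale V c (A k l) \<noteq> 0}" for l
      by (rule finite_subset[of _ "{k. A k l \<noteq> 0}"])
         (use A in \<open>auto simp: annihilating_matrices_def U_infty_def\<close>)
    with A show "mscale V c A \<in> annihilating_matrices"
      by (simp add: annihilating_matrices_def U_infty_def mscale_def vs.subspace_scale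
          subspace_annihilator del: vs.scale_eq_0_iff)
  qed
next
  fix A B :: "nat \<Rightarrow> nat \<Rightarrow> 'v" assume A: "A \<in> U_infty" and B: "B \<in> annihilating_matrices"
  have B': "B \<in> U_infty" using B by (simp add: annihilating_matrices_def)
  have "diamond V A B k l \<in> annihilator k l" "diamond V B A k l \<in> annihilator k l" for k l
    unfolding diamond_def using B
    by (auto intro!: vs.subspace_sum[OF subspace_annihilator] diamond_entry_annihilates
        simp: annihilating_matrices_def)
  then show "diamond V A B \<in> annihilating_matrices" "diamond V B A \<in> annihilating_matrices"
    by (simp_all add: annihilating_matrices_def diamond_in_U_infty A B')
qed (auto simp: annihilating_matrices_def)

lemma matrix_unit_annihilating_iff:
  "matrix_unit v k l \<in> annihilating_matrices \<longleftrightarrow> v \<in> annihilator k l"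
proof
  assume "matrix_unit v k l \<in> annihilating_matrices"
  then have "matrix_unit v k l k l \<in> annihilator k l" by (simp add: annihilating_matrices_def)
  then show "v \<in> annihilator k l" by (simp add: matrix_unit_def)
next
  assume "v \<in> annihilator k l"
  then have "matrix_unit v k l i j \<in> annihilator i j" for i j
    by (simp add: matrix_unit_def vs.subspace_0[OF subspace_annihilator])
  then show "matrix_unit v k l \<in> annihilating_matrices"
    by (simp add: annihilating_matrices_def matrix_unit_in_U_infty)
qed

lemma O_infty_annihilates: "O_infty V \<subseteq> annihilating_matrices"
proof
  fix A assume "A \<in> O_infty V"
  then show "A \<in> annihilating_matrices"
    using vs.span_minimal[OF O_generators_annihilate subspace_annihilator, THEN subsetD]
    by (simp add: O_infty_def annihilating_matrices_def)
qed

lemma J_infty_annihilates: "J_infty V \<subseteq> annihilating_matrices"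
  unfolding J_infty_def
proof (rule module.span_minimal[OF module_mscale])
  show "module.subspace (mscale V) annihilating_matrices"
    using two_sided_ideal_annihilating_matrices by (simp add: two_sided_ideal_def)
  show "{J_element V k l p n h u v | k l p n h u v. l + p \<ge> 0 \<and> v \<in> vgrade V h} \<subseteq> annihilating_matrices"
  proof clarify
    fix k l p n h u v assume "0 \<le> (l::int) + p" and v: "v \<in> vgrade V h"
    then have "l + p = int (nat (l + p))" by simp
    from J_element_eq_matrix_unit[OF this]
    show "J_element V k l p n h u v \<in> annihilating_matrices"
      by (simp only: matrix_unit_annihilating_iff J_entry_annihilates[OF v])
  qed
qed

lemma ideal_annihilates: "ideal_generated V (O_infty V \<union> J_infty V) \<subseteq> annihilating_matrices"
  unfolding ideal_generated_def
  by (rule hull_minimal)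
     (simp_all add: O_infty_annihilates J_infty_annihilates two_sided_ideal_annihilating_matrices)

section \<open>Diagonal shift and the kernel of the action on \<open>Gr(W)\<close>\<close>

lemma annihilator_diagonal_shift: "annihilator (Suc k) (Suc l) \<subseteq> annihilator k l"
  using Omega_mono[of l "Suc l"] by (auto simp: annihilator_def level_op_def)

text \<open>
  Every representative of a coset in degree \<open>n\<close> lies in \<open>\<Omega>\<^sub>n(W)\<close>, so each summand in the definition of
  the action is zero, not merely zero modulo \<open>\<Omega>\<^bsub>k-1\<^esub>(W)\<close>. Representatives must exist for the union over
  them to be the zero coset.
\<close>

lemma matrix_unit_in_theta_kernel:
  assumes "v \<in> annihilator k l"
  shows "matrix_unit v k l \<in> theta_kernel V W"
proof -
  have "theta V W (matrix_unit v k l) g = (\<lambda>i. gr_class V W i 0)" if g: "g \<in> Gr V W" for g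
  proof -
    have coset: "g n \<noteq> {} \<and> g n \<subseteq> Omega V W n" for n
    proof -
      have "g n \<in> gr_class V W n ` Omega V W n" using g by (simp add: Gr_def)
      then obtain x where "x \<in> Omega V W n" "g n = (\<lambda>z. x + z) ` Omega_pred V W n"
        by (auto simp: gr_class_def)
      then show ?thesis
        using zero_in_Omega_pred[of n] Omega_pred_subset[of n] by (auto simp: Omega_add)
    qed
    have vanish: "res_YW V W (int n - int i - 1) (matrix_unit v k l i n) x = 0"
      if "x \<in> Omega V W n" for x i n
      using assms that unfolding level_op_def[symmetric] by (auto simp: matrix_unit_def annihilator_def)
    have "gr_class V W i (\<Sum>n | g n \<noteq> gr_class V W n 0.
        res_YW V W (int n - int i - 1) (matrix_unit v k l i n) (w n)) = gr_class V W i 0"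
      if "\<forall>n. w n \<in> g n" for w i
    proof -
      have "w n \<in> Omega V W n" for n using that coset[of n] by blast
      then show ?thesis by (simp add: vanish)
    qed
    moreover have "\<exists>w. \<forall>n. w n \<in> g n"
      by (rule choice) (use coset in blast)
    ultimately show ?thesis
      unfolding theta_def by (intro ext) blast
  qed
  then show ?thesis by (simp add: theta_kernel_def matrix_unit_in_U_infty)
qed

end

theorem theorem6:
  fixes V :: "'v::ab_group_add vertex_data" and v :: 'v and k l :: nat
  assumes "grading_restricted_vertex_algebra V"
    and "k \<ge> 1" and "l \<ge> 1"
    and "matrix_unit v k l \<in> ideal_generated V (O_infty V \<union> J_infty V)"
  shows "matrix_unit v k l \<in> Q_infty TYPE('w::ab_group_add) V \<and>
         matrix_unit v (k - 1) (l - 1) \<in> Q_infty TYPE('w) V"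
proof -
  have "matrix_unit v k l \<in> theta_kernel V W \<and> matrix_unit v (k - 1) (l - 1) \<in> theta_kernel V W"
    if "lower_bounded_generalized_module V W" for W :: "('v, 'w) module_data"
  proof -
    interpret lower_bounded_generalized_module V W by fact
    have "v \<in> annihilator k l"
      using assms(4) ideal_annihilates matrix_unit_annihilating_iff by blast
    moreover from this have "v \<in> annihilator (k - 1) (l - 1)"
      using annihilator_diagonal_shift[of "k - 1" "l - 1"] assms(2,3) by auto
    ultimately show ?thesis by (simp add: matrix_unit_in_theta_kernel)
  qed
  then show ?thesis by (simp add: Q_infty_def matrix_unit_in_U_infty)
qed

end
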